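(* Let $k\ge 1$, let $\mathbf{A}\in\mathbb{R}^{n\times d}$ be a matrix of rank at least $k$, let $0<\epsilon<\tfrac12$, and let $\mathbf{C}$ be the column submatrix of $\mathbf{A}$ selected by the deterministic ridge leverage score (DRLS) algorithm with parameters $k$ and $\epsilon$. Let $\alpha=2(2+\sqrt2)$. Then for every rank-$k$ orthogonal projection $\mathbf{X}\in\mathbb{R}^{n\times n}$, $$(1-\alpha\epsilon)\,\|\mathbf{A}-\mathbf{X}\mathbf{A}\|_F^2\;\le\;\|\mathbf{C}-\mathbf{X}\mathbf{C}\|_F^2\;\le\;\|\mathbf{A}-\mathbf{X}\mathbf{A}\|_F^2 .$$
   Context: Notation. $\|\cdot\|_F$ is the Frobenius norm; $\mathbf{M}^+$ is the Moore-Penrose pseudoinverse. A rank-$k$ orthogonal projection is a symmetric matrix $\mathbf{X}$ with $\mathbf{X}^2=\mathbf{X}$ and rank $k$. For a matrix $\mathbf{M}$, $\mathbf{M}_k$ is its rank-$k$ truncated SVD approximation (keeping the $k$ largest singular values with their singular vectors) and $\mathbf{M}_{\backslash k}=\mathbf{M}-\mathbf{M}_k$. Ridge leverage scores. For $\mathbf{A}\in\mathbb{R}^{n\times d}$ with columns $\mathbf{a}_1,\dots,\mathbf{a}_d$, $$\bar\tau_i(\mathbf{A})=\mathbf{a}_i^T\left(\mathbf{A}\mathbf{A}^T+\tfrac1k\|\mathbf{A}_{\backslash k}\|_F^2\,\mathbf{I}\right)^+\mathbf{a}_i,\qquad \bar t=\sum_{i=1}^d\bar\tau_i(\mathbf{A}).$$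 DRLS algorithm (parameters $k$, error tolerance $\epsilon>0$). Sort the columns by $\bar\tau_i(\mathbf{A})$ from largest to smallest (ties broken arbitrarily). Starting from the empty set $\Theta$, add column indices to $\Theta$ in this order until $\sum_{i\in\Theta}\bar\tau_i(\mathbf{A})>\bar t-\epsilon$, and then stop. If $|\Theta|<k$, continue adding indices in the same order until $|\Theta|=k$. The output $\mathbf{C}\in\mathbb{R}^{n\times|\Theta|}$ is the submatrix of $\mathbf{A}$ consisting of the (unweighted) columns indexed by $\Theta$; equivalently $\mathbf{C}=\mathbf{A}\mathbf{S}$ with $\mathbf{S}$ the corresponding $d\times|\Theta|$ 0-1 column selection matrix. *)

theory Defs
  imports "HOL-Analysis.Analysis"
begin

text \<open>A matrix with n rows and d columns has type \<open>real^'d^'n\<close>. The norm that the library puts on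
  this type (the Euclidean norm of the rows' Euclidean norms) is the Frobenius norm:\<close>

lemma norm_matrix_frobenius:
  fixes M :: "real^'d^'n"
  shows "norm M = sqrt (\<Sum>i\<in>UNIV. \<Sum>j\<in>UNIV. (M $ i $ j)\<^sup>2)"
  by (simp add: norm_vec_def L2_set_def sum_nonneg)

definition is_pseudoinverse :: "real^'d^'n \<Rightarrow> real^'n^'d \<Rightarrow> bool" where
  "is_pseudoinverse M P \<longleftrightarrow>
     M ** P ** M = M \<and> P ** M ** P = P \<and>
     transpose (M ** P) = M ** P \<and> transpose (P ** M) = P ** M"

definition pseudoinverse :: "real^'d^'n \<Rightarrow> real^'n^'d" where
  "pseudoinverse M = (THE P. is_pseudoinverse M P)"

definition rank_orthogonal_projection :: "nat \<Rightarrow> real^'n^'n \<Rightarrow> bool" where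
  "rank_orthogonal_projection k X \<longleftrightarrow> transpose X = X \<and> X ** X = X \<and> rank X = k"

text \<open>\<open>svd_sum m \<sigma> u v\<close> is the sum of the matrices \<open>\<sigma>\<^sub>i u\<^sub>i v\<^sub>i\<^sup>T\<close> over \<open>i < m\<close>.\<close>

definition svd_sum ::
    "nat \<Rightarrow> (nat \<Rightarrow> real) \<Rightarrow> (nat \<Rightarrow> real^'n) \<Rightarrow> (nat \<Rightarrow> real^'d) \<Rightarrow> real^'d^'n" where
  "svd_sum m \<sigma> u v = (\<Sum>i<m. \<sigma> i *\<^sub>R (\<chi> a b. u i $ a * v i $ b))"

text \<open>The compact singular value decomposition: only the nonzero singular values are listed,
  with multiplicity and in nonincreasing order.\<close>

definition is_svd ::
    "real^'d^'n \<Rightarrow> nat \<Rightarrow> (nat \<Rightarrow> real) \<Rightarrow> (nat \<Rightarrow> real^'n) \<Rightarrow> (nat \<Rightarrow> real^'d) \<Rightarrow> bool" where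
  "is_svd M r \<sigma> u v \<longleftrightarrow>
     (\<forall>i<r. 0 < \<sigma> i) \<and>
     (\<forall>i j. i \<le> j \<longrightarrow> j < r \<longrightarrow> \<sigma> j \<le> \<sigma> i) \<and>
     (\<forall>i<r. \<forall>j<r. u i \<bullet> u j = (if i = j then 1 else 0)) \<and>
     (\<forall>i<r. \<forall>j<r. v i \<bullet> v j = (if i = j then 1 else 0)) \<and>
     M = svd_sum r \<sigma> u v"

text \<open>If the \<open>k\<close>-th and \<open>(k+1)\<close>-st singular values coincide, the truncation depends on the chosen
  decomposition, so one is picked by choice. Only the Frobenius norm of the remainder is used
  below, and it is the same for all choices.\<close>

definition svd_truncation :: "nat \<Rightarrow> real^'d^'n \<Rightarrow> real^'d^'n" where
  "svd_truncation k M = (SOME N. \<exists>r \<sigma> u v. is_svd M r \<sigma> u v \<and> N = svd_sum (min k r) \<sigma> u v)"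

definition svd_remainder :: "nat \<Rightarrow> real^'d^'n \<Rightarrow> real^'d^'n" where
  "svd_remainder k M = M - svd_truncation k M"

definition ridge_leverage_score :: "nat \<Rightarrow> real^'d^'n \<Rightarrow> 'd \<Rightarrow> real" where
  "ridge_leverage_score k A i =
     column i A \<bullet>
       (pseudoinverse (A ** transpose A + (1 / real k * (norm (svd_remainder k A))\<^sup>2) *\<^sub>R mat 1)
          *v column i A)"

text \<open>The list \<open>cs\<close> is an order in which the algorithm may process the columns, and \<open>m\<close> is the number
  of columns after which the score criterion first holds. It holds for \<open>m = CARD('d)\<close> if
  \<open>\<epsilon> > 0\<close>, so that \<open>LEAST\<close> is then well defined.\<close>

definition drls_selects :: "nat \<Rightarrow> real \<Rightarrow> real^'d^'n \<Rightarrow> 'd set \<Rightarrow> bool" where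
  "drls_selects k \<epsilon> A \<Theta> \<longleftrightarrow>
     (\<exists>cs. distinct cs \<and> set cs = UNIV \<and>
        sorted_wrt (\<lambda>i j. ridge_leverage_score k A i \<ge> ridge_leverage_score k A j) cs \<and>
        (let t = (\<Sum>i\<in>UNIV. ridge_leverage_score k A i);
             m = (LEAST m. (\<Sum>i\<in>set (take m cs). ridge_leverage_score k A i) > t - \<epsilon>)
         in \<Theta> = set (take (max m k) cs)))"

text \<open>The index type \<open>'m\<close> of the columns of \<open>C\<close> is in bijection with \<open>\<Theta>\<close>, so \<open>CARD('m) = card \<Theta>\<close>.
  The selected columns may be arranged in any order.\<close>

definition is_column_submatrix :: "real^'d^'n \<Rightarrow> 'd set \<Rightarrow> real^'m^'n \<Rightarrow> bool" where
  "is_column_submatrix A \<Theta> C \<longleftrightarrow>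
     (\<exists>s. bij_betw s UNIV \<Theta> \<and> (\<forall>j. column j C = column (s j) A))"

definition drls_output :: "nat \<Rightarrow> real \<Rightarrow> real^'d^'n \<Rightarrow> real^'m^'n \<Rightarrow> bool" where
  "drls_output k \<epsilon> A C \<longleftrightarrow> (\<exists>\<Theta>. drls_selects k \<epsilon> A \<Theta> \<and> is_column_submatrix A \<Theta> C)"

end

theory Submission
  imports Defs
begin

text \<open>
  Write \<open>P = I - X\<close>, let \<open>a\<^sub>j\<close> be the columns of \<open>A\<close> and \<open>\<tau>\<^sub>j\<close> their ridge leverage scores. Squared
  Frobenius norms add up over columns, so \<open>A - XA\<close> exceeds \<open>C - XC\<close> in squared norm exactly by the
  sum of \<open>\<parallel>P a\<^sub>j\<parallel>\<^sup>2\<close> over the discarded columns. This is nonnegative, which is the upper bound. The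
  algorithm discards columns of total score less than \<open>\<epsilon>\<close>, so the lower bound follows if every
  column satisfies

    \<open>\<parallel>P a\<^sub>j\<parallel>\<^sup>2 \<le> 4 \<tau>\<^sub>j \<parallel>PA\<parallel>\<^sup>2\<close>,

  because \<open>4 \<le> \<alpha>\<close>. This inequality is \<open>residual_le_score\<close>, the heart of the proof.

  To see it, take a singular value decomposition \<open>A = \<Sum>\<^sub>i \<sigma>\<^sub>i u\<^sub>i v\<^sub>i\<^sup>T\<close> and put
  \<open>N = \<parallel>A - A\<^sub>k\<parallel>\<^sup>2\<close>, \<open>\<mu>\<^sub>i = \<sigma>\<^sub>i\<^sup>2 + N/k\<close>. The \<open>u\<^sub>i\<close> are eigenvectors of the ridge matrix with
  eigenvalues \<open>\<mu>\<^sub>i\<close>, so that \<open>\<tau>\<^sub>j = \<Sum>\<^sub>i (\<sigma>\<^sub>i v\<^sub>i\<^sub>j)\<^sup>2 / \<mu>\<^sub>i\<close> (\<open>ridge_quadratic_form_svd\<close>).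
  The column \<open>a\<^sub>j = \<Sum>\<^sub>i \<sigma>\<^sub>i v\<^sub>i\<^sub>j u\<^sub>i\<close> is split into the part on the first \<open>k\<close> singular directions
  and the part on the others, and \<open>\<tau>\<^sub>j\<close> splits accordingly.

  On the lower directions, \<open>\<sigma>\<^sub>i\<^sup>2 \<le> N\<close> and hence \<open>\<mu>\<^sub>i \<le> 2N\<close>: the squared norm of this part is at most
  \<open>2N\<close> times its score, even before \<open>P\<close> is applied. On the top directions the \<open>\<mu>\<^sub>i\<close> may be large,
  but Cauchy-Schwarz bounds the image under \<open>P\<close> by the score of this part times
  \<open>\<Sum>\<^sub>i \<mu>\<^sub>i \<parallel>P u\<^sub>i\<parallel>\<^sup>2 \<le> \<parallel>PA\<parallel>\<^sup>2 + k (N/k)\<close>. There are at most \<open>k\<close> such directions, which is what the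
  ridge parameter \<open>N/k\<close> is made for. By the Eckart-Young inequality \<open>N \<le> \<parallel>PA\<parallel>\<^sup>2\<close>
  (\<open>eckart_young_projection\<close>) both parts are bounded by \<open>2 \<parallel>PA\<parallel>\<^sup>2\<close> times their scores; adding the
  two parts costs another factor 2.

  The singular value decomposition itself is proved to exist by deflation (\<open>svd_exists\<close>), and the
  existence of the Moore-Penrose pseudoinverse is a consequence
  (\<open>pseudoinverse_is_pseudoinverse\<close>).
\<close>

section \<open>Orthonormal families and Frobenius norms\<close>

definition orthonormal_family :: "nat \<Rightarrow> (nat \<Rightarrow> 'a::real_inner) \<Rightarrow> bool" where
  "orthonormal_family r u \<longleftrightarrow> (\<forall>i<r. \<forall>j<r. u i \<bullet> u j = (if i = j then 1 else 0))"

lemma orthonormal_family_norm: "orthonormal_family r u \<Longrightarrow> i < r \<Longrightarrow> norm (u i) = 1"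
  by (simp add: orthonormal_family_def norm_eq_sqrt_inner)

lemma inner_orthonormal_sum:
  assumes "orthonormal_family r u" "i < r" "I \<subseteq> {..<r}"
  shows "u i \<bullet> (\<Sum>j\<in>I. c j *\<^sub>R u j) = (if i \<in> I then c i else 0)"
proof -
  have fin: "finite I" using assms(3) finite_subset by blast
  have "u i \<bullet> (\<Sum>j\<in>I. c j *\<^sub>R u j) = (\<Sum>j\<in>I. c j * (u i \<bullet> u j))"
    by (simp add: inner_sum_right)
  also have "\<dots> = (\<Sum>j\<in>I. if i = j then c j else 0)"
  proof (intro sum.cong refl)
    fix j assume "j \<in> I"
    then have "j < r" using assms(3) by auto
    then show "c j * (u i \<bullet> u j) = (if i = j then c j else 0)"
      using assms(1,2) by (simp add: orthonormal_family_def)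
  qed
  finally show ?thesis using fin by simp
qed

lemma norm_orthonormal_sum:
  assumes "orthonormal_family r u" "I \<subseteq> {..<r}"
  shows "(norm (\<Sum>i\<in>I. c i *\<^sub>R u i))\<^sup>2 = (\<Sum>i\<in>I. (c i)\<^sup>2)"
proof -
  have fin: "finite I" using assms(2) finite_subset by blast
  have "(norm (\<Sum>i\<in>I. c i *\<^sub>R u i))\<^sup>2 = (\<Sum>i\<in>I. (norm (c i *\<^sub>R u i))\<^sup>2)"
    using assms
    by (intro norm_sum_Pythagorean fin)
      (auto simp: pairwise_def orthogonal_def orthonormal_family_def subset_eq)
  also have "\<dots> = (\<Sum>i\<in>I. (c i)\<^sup>2)"
    using assms by (intro sum.cong) (auto simp: orthonormal_family_norm subset_eq)
  finally show ?thesis .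
qed

lemma bessel_inequality:
  assumes "orthonormal_family r u"
  shows "(\<Sum>i<r. (u i \<bullet> x)\<^sup>2) \<le> (norm x)\<^sup>2"
proof -
  define p where "p = (\<Sum>i<r. (u i \<bullet> x) *\<^sub>R u i)"
  have pp: "p \<bullet> p = (\<Sum>i<r. (u i \<bullet> x)\<^sup>2)"
    using norm_orthonormal_sum[OF assms, of "{..<r}" "\<lambda>i. u i \<bullet> x"]
    by (simp add: p_def power2_norm_eq_inner)
  have px: "p \<bullet> x = (\<Sum>i<r. (u i \<bullet> x)\<^sup>2)"
    by (simp add: p_def inner_sum_left power2_eq_square)
  have "0 \<le> (x - p) \<bullet> (x - p)" by simp
  also have "\<dots> = x \<bullet> x - p \<bullet> p"
    using pp px by (simp add: inner_diff inner_commute)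
  finally show ?thesis using pp by (simp add: power2_norm_eq_inner)
qed

lemma norm_matrix_columns:
  fixes M :: "real^'d^'n"
  shows "(norm M)\<^sup>2 = (\<Sum>j\<in>UNIV. (norm (column j M))\<^sup>2)"
proof -
  have "(norm M)\<^sup>2 = (\<Sum>i\<in>UNIV. \<Sum>j\<in>UNIV. (M $ i $ j)\<^sup>2)"
    by (simp add: norm_matrix_frobenius sum_nonneg)
  also have "\<dots> = (\<Sum>j\<in>UNIV. \<Sum>i\<in>UNIV. (M $ i $ j)\<^sup>2)" by (rule sum.swap)
  also have "\<dots> = (\<Sum>j\<in>UNIV. (norm (column j M))\<^sup>2)"
    by (simp add: norm_vec_def L2_set_def sum_nonneg column_def)
  finally show ?thesis .
qed

lemma column_diff_matrix: "column j (M - N) = column j M - column j (N :: real^'d^'n)"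
  by (simp add: column_def vec_eq_iff)

lemma column_matrix_mult: "column j (X ** M) = X *v column j (M :: real^'d^'n)"
  by (simp add: column_def vec_eq_iff matrix_matrix_mult_def matrix_vector_mult_def)

text \<open>Parseval's identity for a matrix with columns \<open>\<Sum>\<^sub>i v\<^sub>i\<^sub>j w\<^sub>i\<close>: expanding the inner products, the sum
  over \<open>j\<close> produces \<open>v\<^sub>i \<bullet> v\<^sub>l\<close>. It computes Frobenius norms from singular value decompositions.\<close>

lemma sum_norm_orthonormal_coordinates:
  fixes v :: "nat \<Rightarrow> real^'d" and w :: "nat \<Rightarrow> 'a::real_inner"
  assumes "orthonormal_family r v" "I \<subseteq> {..<r}"
  shows "(\<Sum>j\<in>UNIV. (norm (\<Sum>i\<in>I. (v i $ j) *\<^sub>R w i))\<^sup>2) = (\<Sum>i\<in>I. (norm (w i))\<^sup>2)"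
proof -
  have fin: "finite I" using assms(2) finite_subset by blast
  have "(\<Sum>j\<in>UNIV. (norm (\<Sum>i\<in>I. (v i $ j) *\<^sub>R w i))\<^sup>2)
      = (\<Sum>j\<in>UNIV. \<Sum>i\<in>I. \<Sum>l\<in>I. (v i $ j * v l $ j) * (w i \<bullet> w l))"
    by (simp add: power2_norm_eq_inner inner_sum_left inner_sum_right mult_ac inner_commute)
  also have "\<dots> = (\<Sum>i\<in>I. \<Sum>l\<in>I. \<Sum>j\<in>UNIV. (v i $ j * v l $ j) * (w i \<bullet> w l))"
    by (subst sum.swap, rule sum.cong[OF refl], rule sum.swap)
  also have "\<dots> = (\<Sum>i\<in>I. \<Sum>l\<in>I. (v i \<bullet> v l) * (w i \<bullet> w l))"
    by (simp add: inner_vec_def sum_distrib_right)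
  also have "\<dots> = (\<Sum>i\<in>I. \<Sum>l\<in>I. if i = l then w i \<bullet> w l else 0)"
  proof (intro sum.cong refl)
    fix i l assume "i \<in> I" "l \<in> I"
    then have "i < r" "l < r" using assms(2) by auto
    then show "(v i \<bullet> v l) * (w i \<bullet> w l) = (if i = l then w i \<bullet> w l else 0)"
      using assms(1) by (simp add: orthonormal_family_def)
  qed
  also have "\<dots> = (\<Sum>i\<in>I. (norm (w i))\<^sup>2)"
    using fin by (simp add: power2_norm_eq_inner)
  finally show ?thesis .
qed

lemma matrix_vector_mult_sum: "(M :: real^'d^'n) *v (\<Sum>i\<in>I. f i) = (\<Sum>i\<in>I. M *v f i)"
  by (rule linear_sum) (rule matrix_vector_mul_linear)

lemma transpose_inner: "(transpose (M :: real^'d^'n) *v y) \<bullet> x = y \<bullet> (M *v x)"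
  by (simp add: dot_lmul_matrix flip: vector_transpose_matrix)

section \<open>Singular value decomposition\<close>

lemma svd_sum_nth: "svd_sum r \<sigma> u v $ a $ b = (\<Sum>i<r. \<sigma> i * (u i $ a * v i $ b))"
  by (simp add: svd_sum_def)

lemma svd_sum_vector: "svd_sum r \<sigma> u v *v x = (\<Sum>i<r. (\<sigma> i * (v i \<bullet> x)) *\<^sub>R u i)"
proof -
  have "(\<Sum>j\<in>UNIV. (\<Sum>i<r. \<sigma> i * (u i $ a * v i $ j)) * x $ j)
      = (\<Sum>i<r. \<Sum>j\<in>UNIV. \<sigma> i * (v i $ j * x $ j) * u i $ a)" for a
    unfolding sum_distrib_right by (subst sum.swap) (simp add: mult_ac)
  then show ?thesis
    by (simp add: vec_eq_iff matrix_vector_mult_def svd_sum_nth inner_vec_def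
        sum_distrib_left sum_distrib_right)
qed

lemma transpose_svd_sum: "transpose (svd_sum r \<sigma> u v) = svd_sum r \<sigma> v u"
  by (simp add: vec_eq_iff transpose_def svd_sum_nth mult_ac)

lemma column_svd_sum: "column j (svd_sum r \<sigma> u v) = (\<Sum>i<r. (\<sigma> i * v i $ j) *\<^sub>R u i)"
  by (simp add: vec_eq_iff column_def svd_sum_nth mult_ac)

lemma svd_sum_mult:
  assumes "orthonormal_family r v"
  shows "svd_sum r \<sigma> u v ** svd_sum r \<tau> v w = svd_sum r (\<lambda>i. \<sigma> i * \<tau> i) u w"
proof -
  have "(svd_sum r \<sigma> u v ** svd_sum r \<tau> v w) *v x = svd_sum r (\<lambda>i. \<sigma> i * \<tau> i) u w *v x" for x
    unfolding matrix_vector_mul_assoc[symmetric] svd_sum_vector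
    by (intro sum.cong refl) (simp add: inner_orthonormal_sum[OF assms])
  then show ?thesis by (simp add: matrix_eq)
qed

lemma is_svd_iff:
  "is_svd M r \<sigma> u v \<longleftrightarrow> (\<forall>i<r. 0 < \<sigma> i) \<and> (\<forall>i j. i \<le> j \<longrightarrow> j < r \<longrightarrow> \<sigma> j \<le> \<sigma> i) \<and>
     orthonormal_family r u \<and> orthonormal_family r v \<and> M = svd_sum r \<sigma> u v"
  by (auto simp: is_svd_def orthonormal_family_def)

lemma is_svd_vectors:
  assumes "is_svd M r \<sigma> u v" "i < r"
  shows "M *v v i = \<sigma> i *\<^sub>R u i" "transpose M *v u i = \<sigma> i *\<^sub>R v i"
proof -
  have ou: "orthonormal_family r u" and ov: "orthonormal_family r v" and M: "M = svd_sum r \<sigma> u v"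
    using assms by (auto simp: is_svd_iff)
  have *: "(\<Sum>j<r. (\<sigma> j * (f j \<bullet> f i)) *\<^sub>R g j) = \<sigma> i *\<^sub>R g i"
    if "orthonormal_family r f" for f :: "nat \<Rightarrow> real^'x" and g :: "nat \<Rightarrow> real^'y"
  proof -
    have "(\<Sum>j<r. (\<sigma> j * (f j \<bullet> f i)) *\<^sub>R g j) = (\<Sum>j<r. if j = i then \<sigma> j *\<^sub>R g j else 0)"
      using that \<open>i < r\<close> by (intro sum.cong) (auto simp: orthonormal_family_def)
    then show ?thesis using \<open>i < r\<close> by simp
  qed
  show "M *v v i = \<sigma> i *\<^sub>R u i" "transpose M *v u i = \<sigma> i *\<^sub>R v i"
    unfolding M transpose_svd_sum svd_sum_vector by (rule *[OF ov], rule *[OF ou])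
qed

text \<open>A unit vector \<open>v\<close> at which \<open>\<parallel>Mv\<parallel>\<close> is maximal, with value \<open>s\<close>, is a right singular vector. With
  \<open>u = Mv / s\<close> and \<open>y = M\<^sup>T u\<close>, the bound \<open>\<parallel>y\<parallel>\<^sup>2 = u \<bullet> M y \<le> s \<parallel>y\<parallel>\<close> gives \<open>\<parallel>y\<parallel> \<le> s\<close>, while
  \<open>y \<bullet> v = u \<bullet> M v = s\<close>; these two force \<open>y = s v\<close>.\<close>

lemma top_singular_pair:
  fixes M :: "real^'d^'n"
  assumes "M \<noteq> 0"
  obtains s u v where "0 < s" "norm u = 1" "norm v = 1" "M *v v = s *\<^sub>R u"
    "transpose M *v u = s *\<^sub>R v" "\<And>x. norm (M *v x) \<le> s * norm x"
proof -
  obtain b :: "real^'d" where b: "b \<in> Basis" using nonempty_Basis by blast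
  then have "sphere (0::real^'d) 1 \<noteq> {}" by (auto intro!: exI[of _ b])
  moreover have "continuous_on (sphere 0 1) (\<lambda>x. norm (M *v x))"
    by (intro continuous_intros)
  ultimately obtain v where v: "norm v = 1" and mx: "\<And>x. norm x = 1 \<Longrightarrow> norm (M *v x) \<le> norm (M *v v)"
    using continuous_attains_sup[of "sphere (0::real^'d) 1" "\<lambda>x. norm (M *v x)"] by auto
  define s where "s = norm (M *v v)"
  have bound: "norm (M *v x) \<le> s * norm x" for x
  proof (cases "x = 0")
    case False
    then have "norm (M *v ((1 / norm x) *\<^sub>R x)) \<le> s"
      unfolding s_def by (intro mx) simp
    then show ?thesis using False by (simp add: matrix_vector_mult_scaleR field_simps)
  qed simp
  have s0: "0 < s"
  proof (rule ccontr)
    assume "\<not> 0 < s"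
    then have "s = 0" by (simp add: s_def)
    then have "M *v x = 0" for x using bound[of x] by simp
    with assms show False by (simp add: matrix_eq)
  qed
  define u where "u = (1/s) *\<^sub>R (M *v v)"
  have u: "norm u = 1" "M *v v = s *\<^sub>R u" using s0 by (auto simp: u_def s_def)
  define y where "y = transpose M *v u"
  have "(norm y)\<^sup>2 = u \<bullet> (M *v y)"
    by (simp add: power2_norm_eq_inner transpose_inner[of M u y, folded y_def])
  also have "\<dots> \<le> norm u * norm (M *v y)" by (rule norm_cauchy_schwarz)
  also have "\<dots> \<le> s * norm y" using bound[of y] u by simp
  finally have ys: "norm y \<le> s" using s0
    by (cases "y = 0") (auto simp: power2_eq_square)
  have yv: "y \<bullet> v = s" using u(1)
    by (simp add: y_def transpose_inner u(2) dot_square_norm del: transpose_matrix_vector)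
  have "(norm (y - s *\<^sub>R v))\<^sup>2 = (norm y)\<^sup>2 - s\<^sup>2"
  proof -
    have "v \<bullet> v = 1" using v by (simp add: dot_square_norm)
    then show ?thesis
      using yv unfolding power2_norm_eq_inner
      by (simp add: inner_diff inner_commute power2_eq_square)
  qed
  also have "\<dots> \<le> 0" using ys power_mono[of "norm y" s 2] by simp
  finally have "y = s *\<^sub>R v" by simp
  then show thesis using that[OF s0 u(1) v u(2)] bound by (simp add: y_def)
qed

lemma svd_sum_case_nat:
  "svd_sum (Suc r) (case_nat s \<sigma>) (case_nat x u) (case_nat y v)
     = s *\<^sub>R (\<chi> a b. x $ a * y $ b) + svd_sum r \<sigma> u v"
  by (simp add: svd_sum_def sum.lessThan_Suc_shift del: sum.lessThan_Suc)

lemma orthonormal_family_case_nat: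
  assumes "orthonormal_family r u" "norm x = 1" "\<And>i. i < r \<Longrightarrow> x \<bullet> u i = 0"
  shows "orthonormal_family (Suc r) (case_nat x u)"
  unfolding orthonormal_family_def
proof (intro allI impI)
  fix i j assume "i < Suc r" "j < Suc r"
  then show "case_nat x u i \<bullet> case_nat x u j = (if i = j then 1 else 0)"
    using assms inner_commute[of "u (i - 1)" x]
    by (cases i; cases j) (auto simp: orthonormal_family_def dot_square_norm[of x])
qed

text \<open>Deflation: subtracting the rank-one term of a top singular pair \<open>(x, y)\<close> with value \<open>s\<close> leaves a
  matrix \<open>M'\<close> whose kernel contains that of \<open>M\<close> and also \<open>y\<close>, so the induction is on the codimension
  of the kernel. All singular vectors of \<open>M'\<close> are orthogonal to \<open>x\<close> and \<open>y\<close>, since \<open>M' y = 0\<close> and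
  the range of \<open>M'\<close> is orthogonal to \<open>x\<close>. The order is kept because \<open>M'\<close> agrees with \<open>M\<close> on vectors
  orthogonal to \<open>y\<close>, and \<open>M\<close> stretches no vector by more than \<open>s\<close>.\<close>

theorem svd_exists:
  fixes M :: "real^'d^'n"
  shows "\<exists>r \<sigma> u v. is_svd M r \<sigma> u v"
proof (induction "CARD('d) - dim {x. M *v x = 0}" arbitrary: M rule: less_induct)
  case less
  show ?case
  proof (cases "M = 0")
    case True
    then have "is_svd M 0 (\<lambda>_. 0) (\<lambda>_. 0) (\<lambda>_. 0)"
      by (simp add: is_svd_def svd_sum_def)
    then show ?thesis by blast
  next
    case False
    then obtain s x y where s: "0 < s" "norm x = 1" "norm y = 1" "M *v y = s *\<^sub>R x"
      "transpose M *v x = s *\<^sub>R y" and bound: "\<And>z. norm (M *v z) \<le> s * norm z"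
      using top_singular_pair by blast
    define M' where "M' = M - s *\<^sub>R (\<chi> a b. x $ a * y $ b)"
    have M'v: "M' *v z = M *v z - (s * (y \<bullet> z)) *\<^sub>R x" for z
      by (simp add: M'_def vec_eq_iff matrix_vector_mult_def inner_vec_def
          left_diff_distrib sum_subtractf sum_distrib_left sum_distrib_right mult.assoc mult.left_commute mult.commute[of "x $ _"])
    have M'y: "M' *v y = 0" using s by (simp add: M'v dot_square_norm)
    have xM': "x \<bullet> (M' *v z) = 0" for z
      using s transpose_inner[of M x z] by (simp add: M'v inner_diff_right dot_square_norm)
    have sub: "subspace {z. N *v z = 0}" for N :: "real^'d^'n"
      by (rule linear_subspace_kernel) (rule matrix_vector_mul_linear)
    have "{z. M *v z = 0} \<subseteq> {z. M' *v z = 0}"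
    proof clarify
      fix z assume z: "M *v z = 0"
      then have "s * (y \<bullet> z) = 0" using s transpose_inner[of M x z] by simp
      then show "M' *v z = 0" using z by (simp add: M'v)
    qed
    moreover have "y \<in> {z. M' *v z = 0}" "y \<notin> {z. M *v z = 0}" using M'y s by auto
    ultimately have "{z. M *v z = 0} \<subset> {z. M' *v z = 0}" by blast
    then have "dim {z. M *v z = 0} < dim {z. M' *v z = 0}"
      using sub dim_psubset[of "{z. M *v z = 0}" "{z. M' *v z = 0}"] span_eq_iff by metis
    moreover have "dim {z. M' *v z = 0} \<le> CARD('d)"
      using dim_subset_UNIV[of "{z. M' *v z = 0}"] by simp
    ultimately have "CARD('d) - dim {z. M' *v z = 0} < CARD('d) - dim {z. M *v z = 0}"
      by linarith
    from less[OF this] obtain r \<sigma> u v where svd: "is_svd M' r \<sigma> u v" by blast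
    then have pos: "\<And>i. i < r \<Longrightarrow> 0 < \<sigma> i" and mono: "\<And>i j. i \<le> j \<Longrightarrow> j < r \<Longrightarrow> \<sigma> j \<le> \<sigma> i"
      and ou: "orthonormal_family r u" and ov: "orthonormal_family r v"
      and M': "M' = svd_sum r \<sigma> u v"
      by (auto simp: is_svd_iff)
    have xu: "x \<bullet> u i = 0" if "i < r" for i
      using xM'[of "v i"] is_svd_vectors[OF svd that] pos[OF that] by simp
    have yv: "y \<bullet> v i = 0" if "i < r" for i
      using transpose_inner[of M' "u i" y] is_svd_vectors[OF svd that] pos[OF that] M'y
      by (simp add: inner_commute)
    have le: "\<sigma> i \<le> s" if "i < r" for i
    proof -
      have "\<sigma> i = norm (M' *v v i)"
        using is_svd_vectors[OF svd that] pos[OF that] orthonormal_family_norm[OF ou that] by simp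
      also have "\<dots> \<le> s"
        using bound[of "v i"] orthonormal_family_norm[OF ov that] by (simp add: M'v yv[OF that])
      finally show ?thesis .
    qed
    have "is_svd M (Suc r) (case_nat s \<sigma>) (case_nat x u) (case_nat y v)"
      unfolding is_svd_iff
    proof (intro conjI allI impI)
      show "orthonormal_family (Suc r) (case_nat x u)" "orthonormal_family (Suc r) (case_nat y v)"
        using orthonormal_family_case_nat ou ov s xu yv by blast+
      show "M = svd_sum (Suc r) (case_nat s \<sigma>) (case_nat x u) (case_nat y v)"
        by (simp add: svd_sum_case_nat flip: M') (simp add: M'_def)
    qed (use s pos mono le in \<open>auto split: nat.split\<close>)
    then show ?thesis by blast
  qed
qed

text \<open>The decomposition behind the choice in \<open>svd_truncation\<close>: working throughout with this one makes
  it unnecessary to compare different decompositions of the same matrix.\<close>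

lemma svd_truncation_svd:
  fixes M :: "real^'d^'n"
  obtains r \<sigma> u v where "is_svd M r \<sigma> u v" "svd_truncation k M = svd_sum (min k r) \<sigma> u v"
proof -
  have "\<exists>N r \<sigma> u v. is_svd M r \<sigma> u v \<and> N = svd_sum (min k r) \<sigma> u v"
    using svd_exists[of M] by blast
  from someI_ex[OF this] that show thesis unfolding svd_truncation_def by blast
qed

lemma norm_svd_tail:
  assumes svd: "is_svd M r \<sigma> u v" and "q \<le> r"
  shows "(norm (M - svd_sum q \<sigma> u v))\<^sup>2 = (\<Sum>i=q..<r. (\<sigma> i)\<^sup>2)"
proof -
  have ou: "orthonormal_family r u" and ov: "orthonormal_family r v" and M: "M = svd_sum r \<sigma> u v"
    using svd by (auto simp: is_svd_iff)
  have "column j (M - svd_sum q \<sigma> u v) = (\<Sum>i=q..<r. v i $ j *\<^sub>R (\<sigma> i *\<^sub>R u i))" for j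
  proof -
    have "column j M = column j (svd_sum q \<sigma> u v) + (\<Sum>i=q..<r. (\<sigma> i * v i $ j) *\<^sub>R u i)"
      unfolding M column_svd_sum lessThan_atLeast0
      by (rule sum.atLeastLessThan_concat[symmetric]) (use \<open>q \<le> r\<close> in auto)
    then show ?thesis by (simp add: column_diff_matrix mult.commute)
  qed
  then have "(norm (M - svd_sum q \<sigma> u v))\<^sup>2 = (\<Sum>i=q..<r. (norm (\<sigma> i *\<^sub>R u i))\<^sup>2)"
    unfolding norm_matrix_columns
    by (simp only:) (rule sum_norm_orthonormal_coordinates[OF ov], auto)
  also have "\<dots> = (\<Sum>i=q..<r. (\<sigma> i)\<^sup>2)"
    by (intro sum.cong) (auto simp: orthonormal_family_norm[OF ou])
  finally show ?thesis .
qed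

lemma norm_residual_svd:
  assumes svd: "is_svd M r \<sigma> u v"
  shows "(norm (M - X ** M))\<^sup>2 = (\<Sum>i<r. (\<sigma> i)\<^sup>2 * (norm (u i - X *v u i))\<^sup>2)"
proof -
  have ov: "orthonormal_family r v" and M: "M = svd_sum r \<sigma> u v"
    using svd by (auto simp: is_svd_iff)
  have "column j (M - X ** M) = (\<Sum>i<r. v i $ j *\<^sub>R (\<sigma> i *\<^sub>R (u i - X *v u i)))" for j
    unfolding M column_diff_matrix column_matrix_mult column_svd_sum
    by (simp add: matrix_vector_mult_sum matrix_vector_mult_scaleR algebra_simps sum_subtractf)
  then have "(norm (M - X ** M))\<^sup>2 = (\<Sum>i<r. (norm (\<sigma> i *\<^sub>R (u i - X *v u i)))\<^sup>2)"
    unfolding norm_matrix_columns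
    by (simp only:) (rule sum_norm_orthonormal_coordinates[OF ov], auto)
  then show ?thesis by (simp add: power_mult_distrib)
qed

section \<open>The pseudoinverse and ridge quadratic forms\<close>

lemma pseudoinverse_unique:
  assumes P: "is_pseudoinverse M P" and Q: "is_pseudoinverse M Q"
  shows "P = Q"
proof -
  have p: "M ** P ** M = M" "P ** M ** P = P" "transpose (M ** P) = M ** P" "transpose (P ** M) = P ** M"
    and q: "M ** Q ** M = M" "Q ** M ** Q = Q" "transpose (M ** Q) = M ** Q" "transpose (Q ** M) = Q ** M"
    using P Q by (auto simp: is_pseudoinverse_def)
  have MPQ: "M ** P = M ** Q"
  proof -
    have "M ** P = transpose ((M ** Q ** M) ** P)" using p q by simp
    also have "\<dots> = transpose ((M ** Q) ** (M ** P))" by (simp add: matrix_mul_assoc)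
    also have "\<dots> = (M ** P) ** (M ** Q)" using p q by (simp add: matrix_transpose_mul)
    also have "\<dots> = M ** Q" using p by (simp add: matrix_mul_assoc)
    finally show ?thesis .
  qed
  have PMQ: "P ** M = Q ** M"
  proof -
    have "P ** M = transpose (P ** (M ** Q ** M))" using p q by simp
    also have "\<dots> = transpose ((P ** M) ** (Q ** M))" by (simp add: matrix_mul_assoc)
    also have "\<dots> = (Q ** M) ** (P ** M)" using p q by (simp add: matrix_transpose_mul)
    also have "\<dots> = Q ** (M ** P ** M)" by (simp add: matrix_mul_assoc)
    finally show ?thesis using p by simp
  qed
  have "P = Q ** M ** P" using p(2) PMQ by simp
  also have "\<dots> = Q ** (M ** P)" by (simp add: matrix_mul_assoc)
  also have "\<dots> = Q" using q(2) MPQ by (simp add: matrix_mul_assoc)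
  finally show ?thesis .
qed

text \<open>Inverting the singular values and exchanging the two families of singular vectors gives a
  pseudoinverse, since products of such sums multiply the coefficients.\<close>

lemma pseudoinverse_is_pseudoinverse:
  fixes M :: "real^'d^'n"
  shows "is_pseudoinverse M (pseudoinverse M)"
proof -
  obtain r \<sigma> u v where svd: "is_svd M r \<sigma> u v" using svd_exists by blast
  define P where "P = svd_sum r (\<lambda>i. 1 / \<sigma> i) v u"
  have pos: "\<And>i. i < r \<Longrightarrow> 0 < \<sigma> i" and ou: "orthonormal_family r u"
    and ov: "orthonormal_family r v" and M: "M = svd_sum r \<sigma> u v"
    using svd by (auto simp: is_svd_iff)
  have cong: "svd_sum r f p q = svd_sum r g p q" if "\<And>i. i < r \<Longrightarrow> f i = g i"
    for f g and p :: "nat \<Rightarrow> real^'x" and q :: "nat \<Rightarrow> real^'y"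
    using that by (simp add: svd_sum_def)
  have "is_pseudoinverse M P"
    unfolding is_pseudoinverse_def M P_def svd_sum_mult[OF ov] svd_sum_mult[OF ou] transpose_svd_sum
    by (intro conjI refl cong) (use pos in \<open>force+\<close>)
  then show ?thesis
    unfolding pseudoinverse_def by (rule theI) (rule pseudoinverse_unique[OF _ \<open>is_pseudoinverse M P\<close>])
qed

text \<open>On the range of a symmetric \<open>K\<close>, the quadratic form of the pseudoinverse follows from
  \<open>K K\<^sup>+ K = K\<close> alone. This treats singular and invertible ridge matrices in the same way.\<close>

lemma pseudoinverse_quadratic_form:
  assumes "transpose K = K"
  shows "(K *v z) \<bullet> (pseudoinverse K *v (K *v z)) = z \<bullet> (K *v z)"
proof -
  have "(K *v z) \<bullet> (pseudoinverse K *v (K *v z)) = z \<bullet> (K *v (pseudoinverse K *v (K *v z)))"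
    using transpose_inner[of K z] assms by simp
  also have "\<dots> = z \<bullet> ((K ** pseudoinverse K ** K) *v z)"
    by (simp add: matrix_vector_mul_assoc matrix_mul_assoc)
  also have "\<dots> = z \<bullet> (K *v z)"
    using pseudoinverse_is_pseudoinverse[of K] by (simp add: is_pseudoinverse_def)
  finally show ?thesis .
qed

text \<open>The left singular vectors of \<open>A\<close> are eigenvectors of \<open>A A\<^sup>T + l I\<close> with the positive eigenvalues
  \<open>\<sigma>\<^sub>i\<^sup>2 + l\<close>, so that the columns of \<open>A\<close> lie in the range of this matrix even if \<open>l = 0\<close>.\<close>

lemma ridge_quadratic_form_svd:
  assumes svd: "is_svd A r \<sigma> u v" and "0 \<le> l"
  shows "column j A \<bullet> (pseudoinverse (A ** transpose A + l *\<^sub>R mat 1) *v column j A)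
     = (\<Sum>i<r. (\<sigma> i * v i $ j)\<^sup>2 / ((\<sigma> i)\<^sup>2 + l))"
proof -
  define K where "K = A ** transpose A + l *\<^sub>R mat 1"
  have pos: "\<And>i. i < r \<Longrightarrow> 0 < (\<sigma> i)\<^sup>2 + l" and ou: "orthonormal_family r u"
    and A: "A = svd_sum r \<sigma> u v"
    using svd \<open>0 \<le> l\<close> by (auto simp: is_svd_iff add_pos_nonneg)
  have symK: "transpose K = K"
    by (simp add: K_def transpose_def matrix_matrix_mult_def vec_eq_iff mat_def mult.commute eq_commute)
  have Ku: "K *v u i = ((\<sigma> i)\<^sup>2 + l) *\<^sub>R u i" if "i < r" for i
  proof -
    have "K *v u i = A *v (transpose A *v u i) + l *\<^sub>R u i"
      by (simp add: K_def matrix_vector_mult_add_rdistrib matrix_vector_mul_assoc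
          del: transpose_matrix_vector flip: scaleR_matrix_vector_assoc)
    then show ?thesis
      using is_svd_vectors[OF svd that]
      by (simp add: matrix_vector_mult_scaleR scaleR_left_distrib power2_eq_square
          del: transpose_matrix_vector)
  qed
  define c where "c i = \<sigma> i * v i $ j / ((\<sigma> i)\<^sup>2 + l)" for i
  define z where "z = (\<Sum>i<r. c i *\<^sub>R u i)"
  have a: "column j A = (\<Sum>i<r. (\<sigma> i * v i $ j) *\<^sub>R u i)"
    unfolding A by (rule column_svd_sum)
  have Kz: "K *v z = column j A"
    unfolding z_def a matrix_vector_mult_sum
    by (intro sum.cong refl) (use pos in \<open>force simp: matrix_vector_mult_scaleR Ku c_def\<close>)
  have "column j A \<bullet> (pseudoinverse K *v column j A) = z \<bullet> column j A"
    using pseudoinverse_quadratic_form[OF symK, of z] by (simp add: Kz)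
  also have "\<dots> = (\<Sum>i<r. c i * (\<sigma> i * v i $ j))"
    unfolding z_def inner_sum_left a
    by (intro sum.cong refl) (simp add: inner_orthonormal_sum[OF ou])
  also have "\<dots> = (\<Sum>i<r. (\<sigma> i * v i $ j)\<^sup>2 / ((\<sigma> i)\<^sup>2 + l))"
    by (simp add: c_def power2_eq_square)
  finally show ?thesis by (simp add: K_def)
qed

section \<open>The Eckart-Young inequality for projections\<close>

lemma projection_Pythagorean:
  fixes X :: "real^'n^'n"
  assumes "transpose X = X" "X ** X = X"
  shows "(norm (x - X *v x))\<^sup>2 = (norm x)\<^sup>2 - (norm (X *v x))\<^sup>2"
proof -
  have "x \<bullet> (X *v x) = (X *v x) \<bullet> (X *v x)"
    using transpose_inner[of X x "X *v x"] assms by (simp add: matrix_vector_mul_assoc)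
  then show ?thesis by (simp add: power2_norm_eq_inner inner_diff inner_commute)
qed

text \<open>In an orthonormal basis \<open>B\<close> of the range of \<open>X\<close>, \<open>\<parallel>X x\<parallel>\<^sup>2 = \<Sum>\<^sub>b (b \<bullet> x)\<^sup>2\<close>. Exchanging the sums,
  Bessel's inequality bounds the contribution of each of the \<open>k\<close> basis vectors by 1.\<close>

lemma sum_norm_projection_le_rank:
  assumes X: "rank_orthogonal_projection k X" and ou: "orthonormal_family r u"
  shows "(\<Sum>i<r. (norm (X *v u i))\<^sup>2) \<le> real k"
proof -
  have sym: "transpose X = X" and idem: "X ** X = X" and rk: "rank X = k"
    using X by (auto simp: rank_orthogonal_projection_def)
  have "subspace (range ((*v) X))" by (simp add: linear_subspace_image subspace_UNIV)
  then obtain B where B: "B \<subseteq> range ((*v) X)" "pairwise orthogonal B"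
      "\<And>b. b \<in> B \<Longrightarrow> norm b = 1" and ind: "independent B"
      and dimB: "card B = dim (range ((*v) X))" and spn: "span B = range ((*v) X)"
    by (rule orthonormal_basis_subspace) (rule that, assumption+)
  have cB: "card B = k" using dimB rk by (simp add: rank_dim_range)
  have fin: "finite B" using ind by (rule independent_imp_finite)
  have nrm: "(norm (X *v x))\<^sup>2 = (\<Sum>b\<in>B. (b \<bullet> x)\<^sup>2)" for x
  proof -
    have bX: "b \<bullet> (X *v x) = b \<bullet> x" if "b \<in> B" for b
    proof -
      obtain w where "b = X *v w" using B(1) \<open>b \<in> B\<close> by auto
      then have "X *v b = b" by (simp add: matrix_vector_mul_assoc idem)
      then show ?thesis using transpose_inner[of X b x] sym by simp
    qed
    have "(\<Sum>b\<in>B. (b \<bullet> (X *v x)) *\<^sub>R b) = X *v x"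
    proof (rule vector_eq_dot_span[of _ B])
      show "X *v x \<in> span B" using spn by auto
    next
      show "(\<Sum>b\<in>B. (b \<bullet> (X *v x)) *\<^sub>R b) \<in> span B"
        by (intro span_sum span_scale span_base)
    next
      fix i assume "i \<in> B"
      have "i \<bullet> (\<Sum>b\<in>B. (b \<bullet> (X *v x)) *\<^sub>R b) = (\<Sum>b\<in>B. if b = i then b \<bullet> (X *v x) else 0)"
        unfolding inner_sum_right
        by (intro sum.cong refl)
          (use B(2,3) \<open>i \<in> B\<close> in \<open>auto simp: pairwise_def orthogonal_def dot_square_norm\<close>)
      then show "i \<bullet> (\<Sum>b\<in>B. (b \<bullet> (X *v x)) *\<^sub>R b) = i \<bullet> (X *v x)"
        using fin \<open>i \<in> B\<close> by simp
    qed
    then have "(norm (X *v x))\<^sup>2 = (norm (\<Sum>b\<in>B. (b \<bullet> x) *\<^sub>R b))\<^sup>2" by (simp add: bX)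
    also have "\<dots> = (\<Sum>b\<in>B. (norm ((b \<bullet> x) *\<^sub>R b))\<^sup>2)"
      using B(2) by (intro norm_sum_Pythagorean fin) (auto simp: pairwise_def orthogonal_def)
    also have "\<dots> = (\<Sum>b\<in>B. (b \<bullet> x)\<^sup>2)" using B(3) by simp
    finally show ?thesis .
  qed
  have "(\<Sum>i<r. (norm (X *v u i))\<^sup>2) = (\<Sum>b\<in>B. \<Sum>i<r. (u i \<bullet> b)\<^sup>2)"
    unfolding nrm by (subst sum.swap) (simp add: inner_commute)
  also have "\<dots> \<le> (\<Sum>b\<in>B. (norm b)\<^sup>2)" by (intro sum_mono bessel_inequality[OF ou])
  also have "\<dots> = real k" using B(3) cB by simp
  finally show ?thesis .
qed

text \<open>With \<open>c\<^sub>i = \<parallel>X u\<^sub>i\<parallel>\<^sup>2\<close>, the projection \<open>X\<close> captures \<open>\<Sum>\<^sub>i c\<^sub>i \<sigma>\<^sub>i\<^sup>2\<close> of the squared norm of \<open>A\<close>, where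
  \<open>0 \<le> c\<^sub>i \<le> 1\<close> and \<open>\<Sum>\<^sub>i c\<^sub>i \<le> k\<close>. Such weights do best when they are 1 on the \<open>k\<close> largest
  singular values.\<close>

lemma eckart_young_projection:
  assumes X: "rank_orthogonal_projection k X" and svd: "is_svd A r \<sigma> u v"
  shows "(\<Sum>i=min k r..<r. (\<sigma> i)\<^sup>2) \<le> (norm (A - X ** A))\<^sup>2"
proof (cases "r \<le> k")
  case False
  define c where "c i = (norm (X *v u i))\<^sup>2" for i
  have pos: "\<And>i. i < r \<Longrightarrow> 0 < \<sigma> i" and mono: "\<And>i j. i \<le> j \<Longrightarrow> j < r \<Longrightarrow> \<sigma> j \<le> \<sigma> i"
    and ou: "orthonormal_family r u"
    using svd by (auto simp: is_svd_iff)
  have sym: "transpose X = X" and idem: "X ** X = X"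
    using X by (auto simp: rank_orthogonal_projection_def)
  have P: "(norm (u i - X *v u i))\<^sup>2 = 1 - c i" if "i < r" for i
    using projection_Pythagorean[OF sym idem, of "u i"] orthonormal_family_norm[OF ou that]
    by (simp add: c_def)
  have c1: "c i \<le> 1" if "i < r" for i using P[OF that] zero_le_power2[of "norm (u i - X *v u i)"] by linarith
  have csum: "(\<Sum>i<r. c i) \<le> real k"
    unfolding c_def by (rule sum_norm_projection_le_rank[OF X ou])
  \<comment> \<open>Indices count from 0, so \<open>\<sigma> k\<close> is the largest singular value outside the first \<open>k\<close>. It serves as
    threshold: \<open>[i < k] - c i\<close> is nonnegative where \<open>\<sigma> i \<ge> \<sigma> k\<close> and nonpositive where \<open>\<sigma> i \<le> \<sigma> k\<close>.\<close>
  have "(\<Sum>i<r. (\<sigma> k)\<^sup>2 * ((if i < k then 1 else 0) - c i))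
      \<le> (\<Sum>i<r. (\<sigma> i)\<^sup>2 * ((if i < k then 1 else 0) - c i))"
  proof (rule sum_mono)
    fix i assume "i \<in> {..<r}"
    then have i: "i < r" by simp
    show "(\<sigma> k)\<^sup>2 * ((if i < k then 1 else 0) - c i) \<le> (\<sigma> i)\<^sup>2 * ((if i < k then 1 else 0) - c i)"
    proof (cases "i < k")
      case True
      then have "(\<sigma> k)\<^sup>2 \<le> (\<sigma> i)\<^sup>2" using mono[of i k] pos[of k] False by (intro power_mono) auto
      then show ?thesis using True c1[OF i] by (simp add: mult_right_mono)
    next
      case ik: False
      then have "(\<sigma> i)\<^sup>2 \<le> (\<sigma> k)\<^sup>2" using mono[of k i] pos[of i] i by (intro power_mono) auto
      then show ?thesis using ik by (simp add: mult_right_mono c_def)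
    qed
  qed
  moreover have "(\<Sum>i<r. (\<sigma> k)\<^sup>2 * ((if i < k then 1 else 0) - c i)) \<ge> 0"
  proof -
    have "(\<Sum>i<r. if i < k then 1 else 0) = real k"
    proof -
      have "{..<r} \<inter> {i. i < k} = {..<k}" using False by auto
      then show ?thesis by (simp add: sum.If_cases)
    qed
    then show ?thesis using csum by (simp add: sum_subtractf flip: sum_distrib_left)
  qed
  moreover have "(norm (A - X ** A))\<^sup>2 - (\<Sum>i=k..<r. (\<sigma> i)\<^sup>2)
      = (\<Sum>i<r. (\<sigma> i)\<^sup>2 * ((if i < k then 1 else 0) - c i))"
  proof -
    have "(\<Sum>i=k..<r. (\<sigma> i)\<^sup>2) = (\<Sum>i<r. if k \<le> i then (\<sigma> i)\<^sup>2 else 0)"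
      by (rule sum.mono_neutral_cong_left) auto
    then show ?thesis
      unfolding norm_residual_svd[OF svd] by (simp add: P flip: sum_subtractf) (rule sum.cong, auto simp: algebra_simps)
  qed
  ultimately show ?thesis using False by (simp add: min_def)
qed (simp add: min_def)

section \<open>Columns are controlled by their ridge leverage scores\<close>

text \<open>Split column \<open>j\<close> along the first \<open>q = min k r\<close> singular directions (\<open>top\<close>) and the remaining ones
  (\<open>bot\<close>), where \<open>r\<close> is the number of nonzero singular values. Here \<open>l\<close> is the ridge parameter, and
  \<open>g i j\<close> is the contribution of direction \<open>i\<close> to the score of column \<open>j\<close>.\<close>

lemma residual_le_score:
  assumes "k \<ge> 1" and X: "rank_orthogonal_projection k X"
  shows "(norm (column j A - X *v column j A))\<^sup>2
     \<le> 4 * ridge_leverage_score k A j * (norm (A - X ** A))\<^sup>2"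
proof -
  obtain r \<sigma> u v where svd: "is_svd A r \<sigma> u v"
    and tr: "svd_truncation k A = svd_sum (min k r) \<sigma> u v" by (rule svd_truncation_svd)
  define q where "q = min k r"
  define N where "N = (\<Sum>i=q..<r. (\<sigma> i)\<^sup>2)"
  define l where "l = N / real k"
  define \<mu> where "\<mu> i = (\<sigma> i)\<^sup>2 + l" for i
  define E where "E = (norm (A - X ** A))\<^sup>2"
  define P where "P x = x - X *v x" for x
  define g where "g i j = (\<sigma> i * v i $ j)\<^sup>2 / \<mu> i" for i j
  have pos: "\<And>i. i < r \<Longrightarrow> 0 < \<sigma> i" and ou: "orthonormal_family r u"
    and A: "A = svd_sum r \<sigma> u v"
    using svd by (auto simp: is_svd_iff)
  have sym: "transpose X = X" and idem: "X ** X = X"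
    using X by (auto simp: rank_orthogonal_projection_def)
  have q: "q \<le> r" "q \<le> k" by (auto simp: q_def)
  have N0: "0 \<le> N" by (simp add: N_def sum_nonneg)
  then have l0: "0 \<le> l" by (simp add: l_def)
  have \<mu>pos: "0 < \<mu> i" if "i < r" for i using pos[OF that] l0 by (simp add: \<mu>_def add_pos_nonneg)
  have g0: "0 \<le> g i j" if "i < r" for i j using \<mu>pos[OF that] by (simp add: g_def)
  have NE: "N \<le> E" unfolding N_def E_def q_def by (rule eckart_young_projection[OF X svd])
  have score: "ridge_leverage_score k A j = (\<Sum>i<q. g i j) + (\<Sum>i=q..<r. g i j)" for j
  proof -
    have "(norm (svd_remainder k A))\<^sup>2 = N"
      unfolding svd_remainder_def tr N_def q_def by (rule norm_svd_tail[OF svd]) simp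
    then have "ridge_leverage_score k A j = (\<Sum>i<r. g i j)"
      unfolding ridge_leverage_score_def g_def \<mu>_def
      using ridge_quadratic_form_svd[OF svd l0, of j] by (simp add: l_def)
    then show ?thesis
      using sum.atLeastLessThan_concat[of 0 q r "\<lambda>i. g i j"] q by (simp add: lessThan_atLeast0)
  qed
  have P_le: "norm (P x) \<le> norm x" for x
  proof -
    have "(norm (P x))\<^sup>2 \<le> (norm x)\<^sup>2"
      unfolding P_def projection_Pythagorean[OF sym idem] by simp
    then show ?thesis by (simp add: power2_le_iff_abs_le)
  qed
  define top where "top j = (\<Sum>i<q. (\<sigma> i * v i $ j) *\<^sub>R u i)" for j
  define bot where "bot j = (\<Sum>i=q..<r. (\<sigma> i * v i $ j) *\<^sub>R u i)" for j
  have bot_le: "(norm (P (bot j)))\<^sup>2 \<le> 2 * E * (\<Sum>i=q..<r. g i j)" for j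
  proof -
    have "(norm (P (bot j)))\<^sup>2 \<le> (norm (bot j))\<^sup>2" by (intro power_mono P_le) simp
    also have "\<dots> = (\<Sum>i=q..<r. (\<sigma> i * v i $ j)\<^sup>2)"
      unfolding bot_def by (rule norm_orthonormal_sum[OF ou]) auto
    also have "\<dots> \<le> (\<Sum>i=q..<r. 2 * E * g i j)"
    proof (rule sum_mono)
      fix i assume i: "i \<in> {q..<r}"
      have "(\<sigma> i)\<^sup>2 \<le> N" unfolding N_def by (rule member_le_sum[OF i]) auto
      moreover have "l \<le> N" using N0 \<open>k \<ge> 1\<close> by (simp add: l_def divide_le_eq mult_left_le mult_le_cancel_left1)
      ultimately have "\<mu> i \<le> 2 * E" using NE by (simp add: \<mu>_def)
      then have "\<mu> i * g i j \<le> 2 * E * g i j" using g0[of i j] i by (intro mult_right_mono) auto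
      then show "(\<sigma> i * v i $ j)\<^sup>2 \<le> 2 * E * g i j" using \<mu>pos[of i] i by (simp add: g_def)
    qed
    finally show ?thesis by (simp add: sum_distrib_left)
  qed
  \<comment> \<open>The ridge adds \<open>l = N / k\<close> to each eigenvalue, and there are only \<open>q \<le> k\<close> top directions, so
    that in total it adds at most \<open>N\<close>.\<close>
  have mass: "(\<Sum>i<q. \<mu> i * (norm (P (u i)))\<^sup>2) \<le> 2 * E"
  proof -
    have "(\<Sum>i<q. (\<sigma> i)\<^sup>2 * (norm (P (u i)))\<^sup>2) \<le> E"
      unfolding E_def norm_residual_svd[OF svd] P_def using q by (intro sum_mono2) auto
    moreover have "(\<Sum>i<q. l * (norm (P (u i)))\<^sup>2) \<le> (\<Sum>i<q. l)"
    proof (rule sum_mono)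
      fix i assume "i \<in> {..<q}"
      then have "norm (P (u i)) \<le> 1" using P_le[of "u i"] orthonormal_family_norm[OF ou, of i] q by simp
      then have "(norm (P (u i)))\<^sup>2 \<le> 1" by (simp add: power_le_one)
      then show "l * (norm (P (u i)))\<^sup>2 \<le> l" using l0 by (rule mult_left_le)
    qed
    moreover have "(\<Sum>i<q. l) \<le> N"
    proof -
      have "real q * l \<le> real k * l" using q l0 by (intro mult_right_mono) auto
      then show ?thesis using \<open>k \<ge> 1\<close> by (simp add: l_def)
    qed
    ultimately show ?thesis using NE by (simp add: \<mu>_def distrib_right sum.distrib)
  qed
  have top_le: "(norm (P (top j)))\<^sup>2 \<le> 2 * E * (\<Sum>i<q. g i j)" for j
  proof -
    have "norm (P (top j)) = norm (\<Sum>i<q. (\<sigma> i * v i $ j) *\<^sub>R P (u i))"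
      by (simp add: P_def top_def matrix_vector_mult_sum matrix_vector_mult_scaleR
          scaleR_diff_right sum_subtractf)
    also have "\<dots> \<le> (\<Sum>i<q. norm ((\<sigma> i * v i $ j) *\<^sub>R P (u i)))" by (rule norm_sum)
    \<comment> \<open>The weights \<open>sqrt (\<mu> i)\<close> are chosen so that Cauchy-Schwarz splits off the score.\<close>
    also have "\<dots> = (\<Sum>i<q. sqrt (g i j) * (sqrt (\<mu> i) * norm (P (u i))))"
    proof (intro sum.cong refl)
      fix i assume "i \<in> {..<q}"
      then have "0 < \<mu> i" using q by (intro \<mu>pos) simp
      then show "norm ((\<sigma> i * v i $ j) *\<^sub>R P (u i)) = sqrt (g i j) * (sqrt (\<mu> i) * norm (P (u i)))"
        by (simp add: g_def real_sqrt_divide)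
    qed
    finally have "(norm (P (top j)))\<^sup>2 \<le> (\<Sum>i<q. sqrt (g i j) * (sqrt (\<mu> i) * norm (P (u i))))\<^sup>2"
      by (rule power_mono) simp
    also have "\<dots> \<le> (\<Sum>i<q. (sqrt (g i j))\<^sup>2) * (\<Sum>i<q. (sqrt (\<mu> i) * norm (P (u i)))\<^sup>2)"
      by (rule Cauchy_Schwarz_ineq_sum)
    also have "\<dots> = (\<Sum>i<q. g i j) * (\<Sum>i<q. \<mu> i * (norm (P (u i)))\<^sup>2)"
      using q g0 \<mu>pos by (simp add: power_mult_distrib less_imp_le)
    also have "\<dots> \<le> (\<Sum>i<q. g i j) * (2 * E)"
      using q g0 by (intro mult_left_mono mass sum_nonneg) simp
    finally show ?thesis by (simp add: mult.commute)
  qed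
  have "(norm (P (column j A)))\<^sup>2 \<le> 4 * E * ridge_leverage_score k A j" for j
  proof -
    have "column j A = top j + bot j"
      unfolding A column_svd_sum top_def bot_def lessThan_atLeast0
      by (rule sum.atLeastLessThan_concat[symmetric]) (use q in auto)
    then have "P (column j A) = P (top j) + P (bot j)"
      by (simp add: P_def matrix_vector_right_distrib)
    then have "norm (P (column j A)) \<le> norm (P (top j)) + norm (P (bot j))"
      by (simp add: norm_triangle_ineq)
    then have "(norm (P (column j A)))\<^sup>2 \<le> (norm (P (top j)) + norm (P (bot j)))\<^sup>2"
      by (rule power_mono) simp
    also have "\<dots> \<le> 2 * (norm (P (top j)))\<^sup>2 + 2 * (norm (P (bot j)))\<^sup>2"
      using sum_squares_bound[of "norm (P (top j))" "norm (P (bot j))"] by (simp add: power2_sum)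
    also have "\<dots> \<le> 4 * E * ridge_leverage_score k A j"
      using top_le[of j] bot_le[of j] by (simp add: score algebra_simps)
    finally show ?thesis .
  qed
  then show ?thesis unfolding P_def E_def by (simp add: mult_ac)
qed

section \<open>The deterministic selection\<close>

lemma ridge_leverage_score_nonneg: "0 \<le> ridge_leverage_score k A j"
proof -
  obtain r \<sigma> u v where svd: "is_svd A r \<sigma> u v" using svd_exists by blast
  have "0 \<le> 1 / real k * (norm (svd_remainder k A))\<^sup>2" by simp
  from ridge_quadratic_form_svd[OF svd this, of j] show ?thesis
    by (simp add: ridge_leverage_score_def sum_nonneg)
qed

text \<open>Taking all columns meets the stopping criterion because \<open>\<epsilon> > 0\<close>, so the least \<open>m\<close> meets it as
  well. Continuing up to \<open>k\<close> columns only moves nonnegative scores to the selected side.\<close>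

lemma drls_selects_discarded_mass:
  fixes A :: "real^'d^'n"
  assumes "drls_selects k \<epsilon> A \<Theta>" "0 < \<epsilon>"
  shows "(\<Sum>j\<in>-\<Theta>. ridge_leverage_score k A j) < \<epsilon>"
proof -
  let ?\<tau> = "ridge_leverage_score k A"
  obtain cs where cs: "set cs = (UNIV :: 'd set)" and \<Theta>: "\<Theta> = set (take (max
      (LEAST m. (\<Sum>i\<in>set (take m cs). ?\<tau> i) > (\<Sum>i\<in>UNIV. ?\<tau> i) - \<epsilon>) k) cs)"
    using assms(1) unfolding drls_selects_def Let_def by blast
  define m where "m = (LEAST m. (\<Sum>i\<in>set (take m cs). ?\<tau> i) > (\<Sum>i\<in>UNIV. ?\<tau> i) - \<epsilon>)"
  have "(\<Sum>i\<in>UNIV. ?\<tau> i) - \<epsilon> < (\<Sum>i\<in>set (take m cs). ?\<tau> i)"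
    unfolding m_def by (rule LeastI[of _ "length cs"]) (use cs \<open>0 < \<epsilon>\<close> in simp)
  also have "\<dots> \<le> (\<Sum>i\<in>\<Theta>. ?\<tau> i)"
    unfolding \<Theta> m_def[symmetric]
    by (intro sum_mono2 set_take_subset_set_take ridge_leverage_score_nonneg) auto
  also have "\<dots> = (\<Sum>i\<in>UNIV. ?\<tau> i) - (\<Sum>j\<in>-\<Theta>. ?\<tau> j)"
    using sum.subset_diff[of \<Theta> UNIV ?\<tau>] by (simp add: Compl_eq_Diff_UNIV)
  finally show ?thesis by simp
qed

theorem theorem3:
  fixes A :: "real^'d^'n" and C :: "real^'m^'n" and k :: nat and \<epsilon> \<alpha> :: real
  assumes "k \<ge> 1" and "rank A \<ge> k" and "0 < \<epsilon>" and "\<epsilon> < 1/2"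
    and "drls_output k \<epsilon> A C"
    and "\<alpha> = 2 * (2 + sqrt 2)"
  shows "\<forall>X :: real^'n^'n. rank_orthogonal_projection k X \<longrightarrow>
           (1 - \<alpha> * \<epsilon>) * (norm (A - X ** A))\<^sup>2 \<le> (norm (C - X ** C))\<^sup>2 \<and>
           (norm (C - X ** C))\<^sup>2 \<le> (norm (A - X ** A))\<^sup>2"
proof (intro allI impI)
  fix X :: "real^'n^'n" assume X: "rank_orthogonal_projection k X"
  obtain \<Theta> s where sel: "drls_selects k \<epsilon> A \<Theta>" and s: "bij_betw s UNIV \<Theta>"
    and C: "\<And>j. column j C = column (s j) A"
    using assms(5) unfolding drls_output_def is_column_submatrix_def by blast
  define f where "f j = (norm (column j A - X *v column j A))\<^sup>2" for j
  have fA: "(norm (A - X ** A))\<^sup>2 = (\<Sum>j\<in>UNIV. f j)"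
    by (simp add: norm_matrix_columns f_def column_diff_matrix column_matrix_mult)
  have fC: "(norm (C - X ** C))\<^sup>2 = (\<Sum>j\<in>\<Theta>. f j)"
    using sum.reindex_bij_betw[OF s, of f]
    by (simp add: norm_matrix_columns f_def column_diff_matrix column_matrix_mult C)
  have split: "(\<Sum>j\<in>UNIV. f j) = (\<Sum>j\<in>\<Theta>. f j) + (\<Sum>j\<in>-\<Theta>. f j)"
    using sum.subset_diff[of \<Theta> UNIV f] by (simp add: Compl_eq_Diff_UNIV)
  have "(\<Sum>j\<in>-\<Theta>. f j) \<le> (\<Sum>j\<in>-\<Theta>. 4 * ridge_leverage_score k A j * (norm (A - X ** A))\<^sup>2)"
    unfolding f_def by (intro sum_mono residual_le_score[OF assms(1) X])
  also have "\<dots> = 4 * (\<Sum>j\<in>-\<Theta>. ridge_leverage_score k A j) * (norm (A - X ** A))\<^sup>2"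
    by (simp add: sum_distrib_left sum_distrib_right)
  also have "\<dots> \<le> \<alpha> * \<epsilon> * (norm (A - X ** A))\<^sup>2"
  proof (rule mult_right_mono)
    have "4 * (\<Sum>j\<in>-\<Theta>. ridge_leverage_score k A j) \<le> 4 * \<epsilon>"
      using drls_selects_discarded_mass[OF sel \<open>0 < \<epsilon>\<close>] by simp
    also have "\<dots> \<le> \<alpha> * \<epsilon>" using assms(3,6) by (intro mult_right_mono) auto
    finally show "4 * (\<Sum>j\<in>-\<Theta>. ridge_leverage_score k A j) \<le> \<alpha> * \<epsilon>" .
  qed simp
  finally have "(\<Sum>j\<in>-\<Theta>. f j) \<le> \<alpha> * \<epsilon> * (norm (A - X ** A))\<^sup>2" .
  moreover have "0 \<le> (\<Sum>j\<in>-\<Theta>. f j)" by (simp add: f_def sum_nonneg)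
  ultimately show "(1 - \<alpha> * \<epsilon>) * (norm (A - X ** A))\<^sup>2 \<le> (norm (C - X ** C))\<^sup>2 \<and>
      (norm (C - X ** C))\<^sup>2 \<le> (norm (A - X ** A))\<^sup>2"
    using split fA fC by (simp add: algebra_simps)
qed

end
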